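(* Let $n=4k+r$ with integers $k\ge 0$ and $0\le r<4$. Then $${\rm ord}_2(t_n)=k+\left\lfloor \tfrac r2\right\rfloor+\delta_{r,3}=\left\lfloor\tfrac n2\right\rfloor-2\left\lfloor\tfrac n4\right\rfloor+\left\lfloor\tfrac{n+1}4\right\rfloor,$$ and the odd factor $\beta_n=t_n/2^{{\rm ord}_2(t_n)}$ satisfies $$\beta_n=\sum_{i=0}^{k}2^{i-\delta_{r,3}}\binom{k}{i}\frac{(1;2)_{k+\lfloor r/2\rfloor}}{(1;2)_{i+\lfloor r/2\rfloor}}\,g_{4i+r}.$$
   Context: $t_n$ is the number of involutions of $[n]$ ($t_0=1$); ${\rm ord}_2(m)$ is the largest $e$ with $2^e\mid m$; $\delta_{r,3}=1$ if $r=3$ and $0$ otherwise. $(a;b)_m=\prod_{j=0}^{m-1}(a+jb)$. For $m=2u+\rho$ with $\rho\in\{0,1\}$, let $V_m=\{v_1,\dots,v_u\}$ if $\rho=0$ and $\{v_1,\dots,v_{u+1}\}$ if $\rho=1$; $\mathfrak{G}_m$ is the set of loopless multigraphs on $V_m$ with all degrees at most $2$, $v_{u+1}$ (if present) of degree at most $1$, and all edge multiplicities at most $2$; $g_m$ is the number of graphs in $\mathfrak{G}_m$ with no edge of multiplicity $2$. *)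

theory Defs
  imports Complex_Main "HOL-Combinatorics.Permutations" "HOL-Library.Multiset"
    "HOL-Computational_Algebra.Primes"
begin

definition involutions :: "nat \<Rightarrow> (nat \<Rightarrow> nat) set" where
  "involutions n = {p. p permutes {1..n} \<and> p \<circ> p = id}"

definition num_involutions :: "nat \<Rightarrow> nat" where
  "num_involutions n = card (involutions n)"

definition ord2 :: "nat \<Rightarrow> nat" where
  "ord2 m = multiplicity 2 m"

definition odd_factor :: "nat \<Rightarrow> rat" where
  "odd_factor n = of_nat (num_involutions n) / 2 ^ ord2 (num_involutions n)"

text \<open>The product \<open>(a;b)\<^sub>m = a (a + b) \<cdots> (a + (m - 1) b)\<close>.\<close>

definition step_prod :: "'a::comm_semiring_1 \<Rightarrow> 'a \<Rightarrow> nat \<Rightarrow> 'a" where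
  "step_prod a b m = (\<Prod>j<m. a + of_nat j * b)"

text \<open>The vertex \<open>v\<^sub>i\<close> is represented by the number \<open>i\<close>. For \<open>m = 2u + \<rho>\<close> with \<open>\<rho> \<in> {0, 1}\<close>,
  we have \<open>u = m div 2\<close> and \<open>\<rho> = m mod 2\<close>.\<close>

definition verts :: "nat \<Rightarrow> nat set" where
  "verts m = {1..m div 2 + m mod 2}"

definition max_deg :: "nat \<Rightarrow> nat \<Rightarrow> nat" where
  "max_deg m v = (if v = m div 2 + 1 then 1 else 2)"

text \<open>A loopless multigraph is the multiset of its edges, an edge being a two-element set of
  vertices; the multiplicity of an edge is its count, so parallel edges are indistinguishable.\<close>

definition mg_degree :: "nat set multiset \<Rightarrow> nat \<Rightarrow> nat" where
  "mg_degree G v = size (filter_mset (\<lambda>e. v \<in> e) G)"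

definition multigraphs :: "nat \<Rightarrow> nat set multiset set" where
  "multigraphs m = {G. (\<forall>e \<in># G. e \<subseteq> verts m \<and> card e = 2) \<and>
     (\<forall>v \<in> verts m. mg_degree G v \<le> max_deg m v) \<and>
     (\<forall>e. count G e \<le> 2)}"

definition num_simple :: "nat \<Rightarrow> nat" where
  "num_simple m = card {G \<in> multigraphs m. \<forall>e. count G e \<noteq> 2}"

end

theory Submission
  imports Defs
begin

text \<open>Pair the elements of \<open>[n]\<close> into blocks \<open>{2i - 1, 2i}\<close>, leaving \<open>n\<close> alone if \<open>n\<close> is odd.
  Contracting the blocks turns an involution into a multigraph, and a multigraph with \<open>d\<close>
  double edges on \<open>u\<close> full blocks arises from \<open>2\<^sup>u\<^sup>-\<^sup>d\<close> involutions. Splitting off the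
  double edges, which form a matching, expresses \<open>t\<^sub>n\<close> as a weighted sum of the numbers \<open>g\<^sub>m\<close> with \<open>m = n - 4d\<close>.
  Instead of following the contraction, one can delete a vertex from a simple graph with degree
  bounds 1 and 2: this gives a recurrence in the numbers of vertices with either bound, and the
  identity follows by induction. All summands but the first one or two are
  divisible by a high enough power of 2, which yields the 2-adic valuation.\<close>

section \<open>Simple graphs with degree bounds, counted by vertex deletion\<close>

definition bounded_graphs :: "'a set \<Rightarrow> ('a \<Rightarrow> nat) \<Rightarrow> 'a set set set" where
  "bounded_graphs V c = {E. (\<forall>e\<in>E. e \<subseteq> V \<and> card e = 2) \<and> (\<forall>v\<in>V. card {e \<in> E. v \<in> e} \<le> c v)}"

text \<open>The third equation deletes a vertex with degree bound 2: this lowers by one the bounds of its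
  neighbours, of which there are none, one or two, each with bound 2 (\<open>a\<close> candidates)
  or 1 (\<open>b\<close> candidates). Terms whose index is truncated at 0 have coefficient 0.\<close>

fun graph_count :: "nat \<Rightarrow> nat \<Rightarrow> nat" where
  "graph_count 0 0 = 1"
| "graph_count 0 (Suc b) = graph_count 0 b + b * graph_count 0 (b - 1)"
| "graph_count (Suc a) b = graph_count a b + a * graph_count (a - 1) (b + 1) + b * graph_count a (b - 1)
     + (a choose 2) * graph_count (a - 2) (b + 2) + a * b * graph_count (a - 1) b
     + (b choose 2) * graph_count a (b - 2)"

lemma finite_bounded_graphs: "finite V \<Longrightarrow> finite (bounded_graphs V c)"
  by (rule finite_subset[of _ "Pow (Pow V)"]) (auto simp: bounded_graphs_def)

text \<open>\<open>S\<close> is the neighbourhood of the new vertex \<open>x\<close>. Each edge at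
  \<open>x\<close> uses up one unit of the bound at its other end; positivity of \<open>c\<close> on
  \<open>S\<close> keeps the truncated subtraction honest.\<close>

lemma bounded_graphs_insert_iff:
  assumes "finite V" "x \<notin> V" and E: "\<forall>e\<in>E. e \<subseteq> V \<and> card e = 2" and S: "S \<subseteq> V"
  shows "E \<union> (\<lambda>v. {x, v}) ` S \<in> bounded_graphs (insert x V) c \<longleftrightarrow>
    card S \<le> c x \<and> (\<forall>v\<in>S. 0 < c v) \<and> E \<in> bounded_graphs V (\<lambda>v. c v - of_bool (v \<in> S))"
proof -
  let ?F = "E \<union> (\<lambda>v. {x, v}) ` S"
  have finE: "finite E"
    by (rule finite_subset[of _ "Pow V"]) (use assms in auto)
  have xS: "x \<notin> S" using assms by auto
  have inj: "inj_on (\<lambda>v. {x, v}) S"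
    using xS by (auto simp: inj_on_def doubleton_eq_iff)
  have "{e \<in> ?F. x \<in> e} = (\<lambda>v. {x, v}) ` S" using assms by auto
  then have degx: "card {e \<in> ?F. x \<in> e} = card S"
    using inj by (simp add: card_image)
  have deg: "card {e \<in> ?F. v \<in> e} = card {e \<in> E. v \<in> e} + of_bool (v \<in> S)" if "v \<in> V" for v
  proof (cases "v \<in> S")
    case True
    have "{e \<in> ?F. v \<in> e} = insert {x, v} {e \<in> E. v \<in> e}" using True that assms by auto
    moreover have "{x, v} \<notin> E" using assms by auto
    ultimately show ?thesis using finE True by simp
  next
    case False
    have "{e \<in> ?F. v \<in> e} = {e \<in> E. v \<in> e}" using False that assms by auto
    then show ?thesis using False by simp
  qed
  have edges: "\<forall>e\<in>?F. e \<subseteq> insert x V \<and> card e = 2"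
    using E S xS by (auto simp: card_insert_if)
  have "?F \<in> bounded_graphs (insert x V) c \<longleftrightarrow>
    card S \<le> c x \<and> (\<forall>v\<in>V. card {e \<in> E. v \<in> e} + of_bool (v \<in> S) \<le> c v)"
    using edges degx deg by (simp add: bounded_graphs_def del: Un_iff)
  also have "(\<forall>v\<in>V. card {e \<in> E. v \<in> e} + of_bool (v \<in> S) \<le> c v) \<longleftrightarrow>
     (\<forall>v\<in>S. 0 < c v) \<and> (\<forall>v\<in>V. card {e \<in> E. v \<in> e} \<le> c v - of_bool (v \<in> S))"
    using S by (fastforce simp: of_bool_def le_diff_conv2 split: if_splits)
  finally show ?thesis using E by (simp add: bounded_graphs_def)
qed

text \<open>A graph is determined by the neighbourhood of \<open>x\<close> together with what
  remains after deleting \<open>x\<close>, so graphs correspond to pairs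
  \<open>(S, E)\<close>.\<close>

lemma card_bounded_graphs_insert:
  assumes "finite V" "x \<notin> V"
  shows "card (bounded_graphs (insert x V) c) =
    (\<Sum>S | S \<subseteq> V \<and> card S \<le> c x \<and> (\<forall>v\<in>S. 0 < c v).
      card (bounded_graphs V (\<lambda>v. c v - of_bool (v \<in> S))))"
proof -
  let ?I = "{S. S \<subseteq> V \<and> card S \<le> c x \<and> (\<forall>v\<in>S. 0 < c v)}"
  let ?D = "SIGMA S:?I. bounded_graphs V (\<lambda>v. c v - of_bool (v \<in> S))"
  let ?f = "\<lambda>(S, E). E \<union> (\<lambda>v. {x, v}) ` S"
  have inj: "inj_on ?f ?D"
  proof (rule inj_on_inverseI[where g = "\<lambda>F. ({v \<in> V. {x, v} \<in> F}, {e \<in> F. x \<notin> e})"])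
    fix p assume "p \<in> ?D"
    then obtain S E where p: "p = (S, E)" "S \<subseteq> V" "\<forall>e\<in>E. e \<subseteq> V"
      by (auto simp: bounded_graphs_def)
    then show "({v \<in> V. {x, v} \<in> ?f p}, {e \<in> ?f p. x \<notin> e}) = p"
      using assms by (auto simp: doubleton_eq_iff)
  qed
  have img: "?f ` ?D = bounded_graphs (insert x V) c"
  proof
    show "?f ` ?D \<subseteq> bounded_graphs (insert x V) c"
    proof clarify
      fix S E assume "S \<subseteq> V" "card S \<le> c x" "\<forall>v\<in>S. 0 < c v"
        and E: "E \<in> bounded_graphs V (\<lambda>v. c v - of_bool (v \<in> S))"
      moreover have "\<forall>e\<in>E. e \<subseteq> V \<and> card e = 2" using E by (auto simp: bounded_graphs_def)
      ultimately show "E \<union> (\<lambda>v. {x, v}) ` S \<in> bounded_graphs (insert x V) c"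
        using bounded_graphs_insert_iff[OF assms] by blast
    qed
    show "bounded_graphs (insert x V) c \<subseteq> ?f ` ?D"
    proof
      fix F assume F: "F \<in> bounded_graphs (insert x V) c"
      define S where "S = {v \<in> V. {x, v} \<in> F}"
      define E where "E = {e \<in> F. x \<notin> e}"
      have E: "\<forall>e\<in>E. e \<subseteq> V \<and> card e = 2" using F by (auto simp: bounded_graphs_def E_def)
      have S: "S \<subseteq> V" by (auto simp: S_def)
      have "e \<in> (\<lambda>v. {x, v}) ` S" if "e \<in> F" "x \<in> e" for e
      proof -
        have e: "card e = 2" "e \<subseteq> insert x V" using F that by (auto simp: bounded_graphs_def)
        from e(1) obtain y z where yz: "e = {y, z}" "y \<noteq> z" by (auto simp: card_2_iff)
        then have "x = y \<or> x = z" using that by auto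
        then obtain y where "e = {x, y}" "y \<noteq> x"
        proof
          assume "x = y"
          then show thesis using yz by (intro that[of z]) auto
        next
          assume "x = z"
          then show thesis using yz by (intro that[of y]) auto
        qed
        then show ?thesis using that e(2) by (auto simp: S_def)
      qed
      then have Feq: "F = E \<union> (\<lambda>v. {x, v}) ` S" by (auto simp: E_def S_def)
      then have "(S, E) \<in> ?D" using F bounded_graphs_insert_iff[OF assms E S, of c] S by auto
      then show "F \<in> ?f ` ?D" using Feq by force
    qed
  qed
  have "card (bounded_graphs (insert x V) c) = card ?D"
    using card_image[OF inj] unfolding img .
  also have "\<dots> = (\<Sum>S\<in>?I. card (bounded_graphs V (\<lambda>v. c v - of_bool (v \<in> S))))"
    by (rule card_SigmaI) (use assms in \<open>auto simp: finite_bounded_graphs\<close>)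
  finally show ?thesis .
qed

text \<open>Grouping subsets by size leaves sizes 0, 1 and 2 only. Applied to neighbourhoods, this
  yields the binomial coefficients of \<open>graph_count\<close>.\<close>

lemma sum_Pow_card:
  fixes h :: "nat \<Rightarrow> nat"
  assumes "finite A" and h: "\<And>i. 2 < i \<Longrightarrow> h i = 0"
  shows "(\<Sum>X\<in>Pow A. h (card X)) = h 0 + card A * h 1 + (card A choose 2) * h 2"
proof -
  have "(\<Sum>X\<in>Pow A. h (card X)) = (\<Sum>X | X \<subseteq> A \<and> card X \<le> 2. h (card X))"
    using assms(1) h by (intro sum.mono_neutral_right) (auto simp: not_le)
  also have "\<dots> = (\<Sum>i\<le>2. \<Sum>X | X \<in> {X. X \<subseteq> A \<and> card X \<le> 2} \<and> card X = i. h (card X))"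
    using assms by (intro sum.group[symmetric]) auto
  also have "\<dots> = (\<Sum>i\<le>2. (card A choose i) * h i)"
  proof (rule sum.cong[OF refl])
    fix i :: nat assume "i \<in> {..2}"
    then have "{X. X \<in> {X. X \<subseteq> A \<and> card X \<le> 2} \<and> card X = i} = {X. X \<subseteq> A \<and> card X = i}" by auto
    then show "(\<Sum>X | X \<in> {X. X \<subseteq> A \<and> card X \<le> 2} \<and> card X = i. h (card X)) = (card A choose i) * h i"
      using n_subsets[OF assms(1), of i] by simp
  qed
  finally show ?thesis by (simp add: numeral_2_eq_2)
qed

text \<open>Vertices with bound 0 are isolated, so only the numbers of vertices with bounds 2 and 1
  matter. The induction deletes a vertex of bound 2 while there is one, then vertices of bound
  1.\<close>

lemma card_bounded_graphs:
  assumes "finite V" and "\<forall>v\<in>V. c v \<le> 2"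
  shows "card (bounded_graphs V c) = graph_count (card {v \<in> V. c v = 2}) (card {v \<in> V. c v = 1})"
  using assms
proof (induction "card V" arbitrary: V c rule: less_induct)
  case less
  \<comment> \<open>The neighbourhood of \<open>x\<close> splits into \<open>X\<close>, with bound
    2, and \<open>Y\<close>, with bound 1. After deletion \<open>X\<close> moves from
    \<open>A\<close> to the vertices of bound 1, and \<open>Y\<close> drops out with bound
    0.\<close>
  have rec: "card (bounded_graphs (insert x W) c) =
      (\<Sum>X\<in>Pow A. \<Sum>Y\<in>Pow B. if card X + card Y \<le> c x
         then graph_count (card A - card X) (card B - card Y + card X) else 0)"
    if V: "V = insert x W" "x \<notin> W" and A: "A = {v \<in> W. c v = 2}" and B: "B = {v \<in> W. c v = 1}"
    for x W A B
  proof -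
    have fin: "finite W" "finite A" "finite B" using less.prems V A B by auto
    have disj: "A \<inter> B = {}" using A B by auto
    let ?I = "{S. S \<subseteq> W \<and> card S \<le> c x \<and> (\<forall>v\<in>S. 0 < c v)}"
    let ?K = "{p \<in> Pow A \<times> Pow B. card (fst p) + card (snd p) \<le> c x}"
    have cW: "c v = 0 \<or> c v = 1 \<or> c v = 2" if "v \<in> W" for v
      using less.prems(2) V that by force
    have split: "S = (S \<inter> A) \<union> (S \<inter> B)" if "S \<subseteq> W" "\<forall>v\<in>S. 0 < c v" for S
      using that cW by (fastforce simp: A B)
    have cardU: "card (X \<union> Y) = card X + card Y" if "X \<subseteq> A" "Y \<subseteq> B" for X Y
      using that disj fin by (intro card_Un_disjoint) (auto intro: finite_subset)
    have "card (bounded_graphs (insert x W) c) =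
       (\<Sum>S\<in>?I. card (bounded_graphs W (\<lambda>v. c v - of_bool (v \<in> S))))"
      using card_bounded_graphs_insert[OF fin(1) V(2)] .
    also have "\<dots> = (\<Sum>p\<in>?K. card (bounded_graphs W (\<lambda>v. c v - of_bool (v \<in> fst p \<union> snd p))))"
    proof (rule sum.reindex_bij_witness[where i = "\<lambda>p. fst p \<union> snd p" and j = "\<lambda>S. (S \<inter> A, S \<inter> B)"], goal_cases)
      case (1 S)
      then show ?case using split[of S] by auto
    next
      case (2 S)
      then show ?case using split[of S] cardU[of "S \<inter> A" "S \<inter> B"] by auto
    next
      case (3 p)
      then show ?case using disj by (cases p) auto
    next
      case (4 p)
      then show ?case using cardU[of "fst p" "snd p"] by (auto simp: A B)
    next
      case (5 S)
      then have "(S \<inter> A) \<union> (S \<inter> B) = S" using split[of S] by auto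
      then show ?case by simp
    qed
    also have "\<dots> = (\<Sum>p\<in>?K. graph_count (card A - card (fst p)) (card B - card (snd p) + card (fst p)))"
    proof (rule sum.cong[OF refl])
      fix p assume "p \<in> ?K"
      then obtain X Y where p: "p = (X, Y)" and XY: "X \<subseteq> A" "Y \<subseteq> B" by (cases p) auto
      let ?c = "\<lambda>v. c v - of_bool (v \<in> X \<union> Y)"
      have "card W < card V" using V fin by simp
      moreover have "\<forall>v\<in>W. ?c v \<le> 2"
        using less.prems(2) V by (meson diff_le_self insertI2 le_trans)
      ultimately have "card (bounded_graphs W ?c) =
          graph_count (card {v \<in> W. ?c v = 2}) (card {v \<in> W. ?c v = 1})"
        using less.hyps[of W ?c] fin by blast
      moreover have "{v \<in> W. ?c v = 2} = A - X"
        using XY cW by (fastforce simp: A B of_bool_def split: if_splits)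
      moreover have "{v \<in> W. ?c v = 1} = (B - Y) \<union> X"
        using XY disj cW by (fastforce simp: A B of_bool_def split: if_splits)
      moreover have "card (A - X) = card A - card X"
        using XY fin by (simp add: card_Diff_subset finite_subset)
      moreover have "card (B - Y \<union> X) = card (B - Y) + card X"
        using XY fin disj by (intro card_Un_disjoint) (auto intro: finite_subset)
      moreover have "card (B - Y) = card B - card Y"
        using XY fin by (simp add: card_Diff_subset finite_subset)
      ultimately show "card (bounded_graphs W (\<lambda>v. c v - of_bool (v \<in> fst p \<union> snd p))) =
         graph_count (card A - card (fst p)) (card B - card (snd p) + card (fst p))"
        by (simp add: p)
    qed
    also have "\<dots> = (\<Sum>p\<in>Pow A \<times> Pow B. if card (fst p) + card (snd p) \<le> c x then
       graph_count (card A - card (fst p)) (card B - card (snd p) + card (fst p)) else 0)"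
      using fin by (subst sum.inter_filter) auto
    finally show ?thesis by (simp add: sum.cartesian_product case_prod_unfold)
  qed
  consider (two) x where "x \<in> V" "c x = 2" | (one) x where "x \<in> V" "c x = 1" "\<forall>v\<in>V. c v \<noteq> 2"
    | (zero) "\<forall>v\<in>V. c v = 0"
    using less.prems(2) by (metis One_nat_def le_SucE le_zero_eq numeral_2_eq_2)
  then show ?case
  proof cases
    case two
    define W where "W = V - {x}"
    define A where "A = {v \<in> W. c v = 2}"
    define B where "B = {v \<in> W. c v = 1}"
    have V: "V = insert x W" "x \<notin> W" using two by (auto simp: W_def)
    have fin: "finite A" "finite B" using less.prems by (auto simp: A_def B_def W_def)
    have V2: "{v \<in> V. c v = 2} = insert x A" "x \<notin> A" using V two by (auto simp: A_def)
    have V1: "{v \<in> V. c v = 1} = B" using V two by (auto simp: B_def)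
    have inner: "(\<Sum>Y\<in>Pow B. if card X + card Y \<le> c x
         then graph_count (card A - card X) (card B - card Y + card X) else 0) =
       (if card X \<le> 2 then graph_count (card A - card X) (card B + card X) else 0)
       + card B * (if card X + 1 \<le> 2 then graph_count (card A - card X) (card B - 1 + card X) else 0)
       + (card B choose 2) * (if card X = 0 then graph_count (card A) (card B - 2) else 0)" for X
      using sum_Pow_card[OF fin(2), of "\<lambda>j. if card X + j \<le> c x
         then graph_count (card A - card X) (card B - j + card X) else 0"] two(2) by simp
    have outer: "(\<Sum>X\<in>Pow A. (if card X \<le> 2 then graph_count (card A - card X) (card B + card X) else 0)
       + card B * (if card X + 1 \<le> 2 then graph_count (card A - card X) (card B - 1 + card X) else 0)
       + (card B choose 2) * (if card X = 0 then graph_count (card A) (card B - 2) else 0)) =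
       graph_count (Suc (card A)) (card B)"
    proof -
      \<comment> \<open>The recurrence regrouped by the number of neighbours in \<open>A\<close>.
        The index \<open>b - 1 + 1\<close> differs from \<open>b\<close> only at
        \<open>b = 0\<close>, where its coefficient vanishes.\<close>
      have "graph_count (Suc a) b = graph_count a b + b * graph_count a (b - 1)
          + (b choose 2) * graph_count a (b - 2)
          + a * (graph_count (a - 1) (b + 1) + b * graph_count (a - 1) (b - 1 + 1))
          + (a choose 2) * graph_count (a - 2) (b + 2)" for a b
        by (cases b) (auto simp: algebra_simps)
      then show ?thesis
        by (subst sum_Pow_card[OF fin(1), of "\<lambda>i. (if i \<le> 2 then graph_count (card A - i) (card B + i) else 0)
         + card B * (if i + 1 \<le> 2 then graph_count (card A - i) (card B - 1 + i) else 0)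
         + (card B choose 2) * (if i = 0 then graph_count (card A) (card B - 2) else 0)"]) simp_all
    qed
    have "card (bounded_graphs V c) = graph_count (Suc (card A)) (card B)"
      using rec[OF V A_def B_def] unfolding inner outer V(1)[symmetric] .
    then show ?thesis using V1 V2 fin by simp
  next
    case one
    define W where "W = V - {x}"
    define B where "B = {v \<in> W. c v = 1}"
    have V: "V = insert x W" "x \<notin> W" using one by (auto simp: W_def)
    have fin: "finite B" using less.prems by (auto simp: B_def W_def)
    have A: "{} = {v \<in> W. c v = 2}" using V one by auto
    have V2: "{v \<in> V. c v = 2} = {}" using one by auto
    have V1: "{v \<in> V. c v = 1} = insert x B" "x \<notin> B" using V one by (auto simp: B_def)
    \<comment> \<open>Now \<open>x\<close> is isolated or has a single neighbour, which lies in
      \<open>B\<close>: the second equation of \<open>graph_count\<close>.\<close>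
    have sum: "(\<Sum>Y\<in>Pow B. if card Y \<le> 1 then graph_count 0 (card B - card Y) else 0) =
       graph_count 0 (Suc (card B))"
      using sum_Pow_card[OF fin, of "\<lambda>j. if j \<le> 1 then graph_count 0 (card B - j) else 0"] by simp
    have "card (bounded_graphs V c) = graph_count 0 (Suc (card B))"
    proof -
      have "card (bounded_graphs V c) = (\<Sum>Y\<in>Pow B. if card Y \<le> 1 then graph_count 0 (card B - card Y) else 0)"
        using rec[OF V A B_def] unfolding V(1)[symmetric] one(2) by (simp cong: if_cong)
      then show ?thesis using sum by simp
    qed
    then show ?thesis using V1 fin unfolding V2 by simp
  next
    case zero
    have "E = {}" if "E \<in> bounded_graphs V c" for E
    proof (rule ccontr)
      assume "E \<noteq> {}"
      then obtain e where e: "e \<in> E" by auto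
      then have "e \<subseteq> V" "card e = 2" using that by (auto simp: bounded_graphs_def)
      then obtain v where v: "v \<in> e" "v \<in> V"
        by (metis card.empty ex_in_conv subsetD zero_neq_numeral)
      have "finite E" using that less.prems
        by (intro finite_subset[of E "Pow V"]) (auto simp: bounded_graphs_def)
      moreover have "card {e \<in> E. v \<in> e} = 0" using that zero v by (auto simp: bounded_graphs_def)
      ultimately show False using e v by auto
    qed
    moreover have "{} \<in> bounded_graphs V c" by (simp add: bounded_graphs_def)
    ultimately have "bounded_graphs V c = {{}}" by auto
    moreover have V: "{v \<in> V. c v = 2} = {}" "{v \<in> V. c v = 1} = {}" using zero by auto
    ultimately show ?thesis unfolding V by simp
  qed
qed

section \<open>The numbers g_m in terms of \<open>graph_count\<close>\<close>

text \<open>Without double edges all multiplicities are 0 or 1, so the multiset of edges can be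
  replaced by its support.\<close>

lemma num_simple_eq: "num_simple m = graph_count (m div 2) (m mod 2)"
proof -
  let ?M = "{G \<in> multigraphs m. \<forall>e. count G e \<noteq> 2}"
  let ?B = "bounded_graphs (verts m) (max_deg m)"
  have fin: "finite E" if "E \<in> ?B" for E
    by (rule finite_subset[of E "Pow (verts m)"]) (use that in \<open>auto simp: bounded_graphs_def verts_def\<close>)
  have simple: "mset_set (set_mset G) = G" if "G \<in> ?M" for G
  proof (rule multiset_eqI)
    fix e
    have "count G e \<le> 2" "count G e \<noteq> 2" using that by (auto simp: multigraphs_def)
    then have "count G e = 0 \<or> count G e = 1" by linarith
    then show "count (mset_set (set_mset G)) e = count G e"
    proof
      assume "count G e = 0"
      then have "e \<notin># G" by (simp add: not_in_iff)
      then show ?thesis using \<open>count G e = 0\<close> by simp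
    next
      assume "count G e = 1"
      then have "e \<in># G" by (simp flip: count_greater_zero_iff)
      then show ?thesis using \<open>count G e = 1\<close> by simp
    qed
  qed
  have deg: "mg_degree (mset_set E) v = card {e \<in> E. v \<in> e}" if "finite E"
    for E :: "nat set set" and v
    using that by (simp add: mg_degree_def filter_mset_mset_set)
  have "bij_betw mset_set ?B ?M"
  proof (rule bij_betw_byWitness[where f' = set_mset])
    show "\<forall>E\<in>?B. set_mset (mset_set E) = E" using fin by simp
    show "\<forall>G\<in>?M. mset_set (set_mset G) = G" using simple by blast
    show "mset_set ` ?B \<subseteq> ?M"
    proof clarify
      fix E assume E: "E \<in> ?B"
      then show "mset_set E \<in> multigraphs m \<and> (\<forall>e. count (mset_set E) e \<noteq> 2)"
        using fin[OF E] by (simp add: multigraphs_def bounded_graphs_def deg count_mset_set')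
    qed
    show "set_mset ` ?M \<subseteq> ?B"
    proof clarify
      fix G assume G: "G \<in> multigraphs m" "\<forall>e. count G e \<noteq> 2"
      then have "mg_degree G v = card {e \<in> set_mset G. v \<in> e}" for v
        using deg[of "set_mset G" v] simple[of G] by simp
      then show "set_mset G \<in> ?B" using G by (simp add: multigraphs_def bounded_graphs_def)
    qed
  qed
  then have "num_simple m = card ?B" by (simp add: num_simple_def bij_betw_same_card)
  also have "\<dots> = graph_count (card {v \<in> verts m. max_deg m v = 2}) (card {v \<in> verts m. max_deg m v = 1})"
    by (rule card_bounded_graphs) (auto simp: verts_def max_deg_def)
  also have "{v \<in> verts m. max_deg m v = 2} = {1..m div 2}"
    by (auto simp: verts_def max_deg_def)
  \<comment> \<open>The number with bound 1 is a vertex only if \<open>m\<close> is odd.\<close>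
  also have "{v \<in> verts m. max_deg m v = 1} = (if m mod 2 = 1 then {m div 2 + 1} else {})"
    by (auto simp: verts_def max_deg_def)
  finally show ?thesis by (auto simp: not_mod_2_eq_1_eq_0)
qed

section \<open>Involutions and their recurrence\<close>

definition involutions_on :: "'a set \<Rightarrow> ('a \<Rightarrow> 'a) set" where
  "involutions_on A = {p. p permutes A \<and> p \<circ> p = id}"

lemma involutions_on_iff:
  "p \<in> involutions_on A \<longleftrightarrow> (\<forall>z. z \<notin> A \<longrightarrow> p z = z) \<and> (\<forall>z. p (p z) = z)"
proof -
  have "bij p" if "\<forall>z. p (p z) = z" using that by (metis involuntory_imp_bij)
  then show ?thesis
    by (auto simp: involutions_on_def permutes_def fun_eq_iff) (metis)+
qed

text \<open>Composition with the transposition of \<open>x\<close> and \<open>y\<close> adds or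
  removes that 2-cycle; being its own inverse, the same map serves in both directions.\<close>

lemma involutions_on_insert_swap:
  assumes "x \<notin> A" "y \<in> A"
  shows "bij_betw (\<lambda>q. transpose x y \<circ> q) (involutions_on (A - {y}))
    {p \<in> involutions_on (insert x A). p x = y}"
proof (rule bij_betw_byWitness[where f' = "\<lambda>p. transpose x y \<circ> p"])
  have xy: "x \<noteq> y" using assms by auto
  show "(\<lambda>q. transpose x y \<circ> q) ` involutions_on (A - {y})
      \<subseteq> {p \<in> involutions_on (insert x A). p x = y}"
  proof clarify
    fix q assume q: "q \<in> involutions_on (A - {y})"
    then have fx: "q x = x" "q y = y" and qq: "\<And>z. q (q z) = z"
      using assms by (auto simp: involutions_on_iff)
    have "transpose x y (q z) = q z" if "z \<noteq> x" "z \<noteq> y" for z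
      using that fx qq by (metis transpose_apply_other)
    then have "(transpose x y \<circ> q) ((transpose x y \<circ> q) z) = z" for z
      using fx qq xy by (cases "z = x"; cases "z = y") auto
    moreover have "(transpose x y \<circ> q) z = z" if "z \<notin> insert x A" for z
    proof -
      have "z \<noteq> y" "q z = z" using that q assms by (auto simp: involutions_on_iff)
      then show ?thesis using that by simp
    qed
    ultimately show "transpose x y \<circ> q \<in> involutions_on (insert x A) \<and> (transpose x y \<circ> q) x = y"
      using fx unfolding involutions_on_iff by simp
  qed
  show "(\<lambda>q. transpose x y \<circ> q) ` {p \<in> involutions_on (insert x A). p x = y}
      \<subseteq> involutions_on (A - {y})"
  proof clarify
    fix q assume q: "q \<in> involutions_on (insert x A)" and y: "y = q x"
    then have fx: "q x = y" "q y = x" and qq: "\<And>z. q (q z) = z"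
      by (auto simp: involutions_on_iff)
    have "transpose x y (q z) = q z" if "z \<noteq> x" "z \<noteq> y" for z
      using that fx qq by (metis transpose_apply_other)
    then have "(transpose x y \<circ> q) ((transpose x y \<circ> q) z) = z" for z
      using fx qq xy by (cases "z = x"; cases "z = y") auto
    moreover have "(transpose x y \<circ> q) z = z" if "z \<notin> A - {y}" for z
      using q assms fx that by (cases "z = x"; cases "z = y") (auto simp: involutions_on_iff)
    ultimately show "transpose x (q x) \<circ> q \<in> involutions_on (A - {q x})"
      unfolding involutions_on_iff y[symmetric] by blast
  qed
qed (auto simp: fun_eq_iff)

lemma finite_involutions_on: "finite A \<Longrightarrow> finite (involutions_on A)"
  by (rule finite_subset[OF _ finite_permutations]) (auto simp: involutions_on_def)

text \<open>A chosen point \<open>x\<close> is fixed or swapped with one of the other points, which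
  gives t_(n+1) = t_n + n t_(n-1), the recurrence of \<open>graph_count 0\<close>.\<close>

lemma card_involutions_on: "finite A \<Longrightarrow> card (involutions_on A) = graph_count 0 (card A)"
proof (induction "card A" arbitrary: A rule: less_induct)
  case less
  show ?case
  proof (cases "A = {}")
    case True
    then have "involutions_on A = {id}" by (auto simp: involutions_on_def)
    then show ?thesis using True by simp
  next
    case False
    then obtain x B where A: "A = insert x B" "x \<notin> B" by (meson Set.set_insert ex_in_conv)
    then have fin: "finite B" using less.prems by simp
    let ?C = "\<lambda>y. {p \<in> involutions_on A. p x = y}"
    have "p x \<in> A" if "p \<in> involutions_on A" for p
      using that A permutes_in_image[of p A x] by (simp add: involutions_on_def)
    then have "involutions_on A = (\<Union>y\<in>A. ?C y)" by auto
    then have "card (involutions_on A) = (\<Sum>y\<in>A. card (?C y))"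
      using less.prems by (subst card_UN_disjoint[symmetric]) (auto simp: finite_involutions_on)
    also have "\<dots> = card (?C x) + (\<Sum>y\<in>B. card (?C y))" using A fin by simp
    also have "?C x = involutions_on B"
      using A by (auto simp: involutions_on_iff)
    also have "card (involutions_on B) = graph_count 0 (card B)"
      using less.hyps[of B] A fin by simp
    also have "(\<Sum>y\<in>B. card (?C y)) = (\<Sum>y\<in>B. graph_count 0 (card B - 1))"
    proof (rule sum.cong[OF refl])
      fix y assume y: "y \<in> B"
      have "card (?C y) = card (involutions_on (B - {y}))"
        using bij_betw_same_card[OF involutions_on_insert_swap[OF A(2) y]] A by simp
      also have "\<dots> = graph_count 0 (card (B - {y}))"
        using A fin by (intro less.hyps) (auto simp: less_Suc_eq_le card_Diff1_le)
      finally show "card (?C y) = graph_count 0 (card B - 1)" using y fin by simp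
    qed
    finally show ?thesis using A fin by simp
  qed
qed

lemma num_involutions_eq: "num_involutions n = graph_count 0 n"
  using card_involutions_on[of "{1..n}"]
  by (simp add: num_involutions_def involutions_def involutions_on_def)

section \<open>Matchings of the complete graph\<close>

text \<open>The number of matchings with \<open>d\<close> edges on \<open>a\<close> labelled
  vertices: choose the covered vertices, then one of the (2d - 1)!! perfect matchings on
  them.\<close>

definition matching_count :: "nat \<Rightarrow> nat \<Rightarrow> nat" where
  "matching_count a d = (a choose (2 * d)) * (\<Prod>j<d. 2 * j + 1)"

lemma matching_count_eq_0: "a < 2 * d \<Longrightarrow> matching_count a d = 0"
  by (simp add: matching_count_def)

lemma matching_count_0 [simp]: "matching_count a 0 = 1"
  by (simp add: matching_count_def)

text \<open>The last vertex is uncovered, or is matched with one of the \<open>a\<close>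
  others.\<close>

lemma matching_count_Suc_Suc:
  "matching_count (Suc a) (Suc d) = matching_count a (Suc d) + a * matching_count (a - 1) d"
proof (cases a)
  case (Suc m)
  have "Suc (2 * d) * (Suc m choose Suc (2 * d)) = Suc m * (m choose (2 * d))"
    using Suc_times_binomial_eq[of m "2 * d"] by (simp add: mult.commute)
  moreover have "matching_count (Suc a) (Suc d) = matching_count a (Suc d)
      + Suc (2 * d) * (Suc m choose Suc (2 * d)) * (\<Prod>j<d. 2 * j + 1)"
    by (simp add: Suc matching_count_def algebra_simps)
  ultimately show ?thesis by (simp only: Suc matching_count_def diff_Suc_1 mult.assoc)
qed (simp add: matching_count_def)

text \<open>Both sides count matchings with a marked uncovered vertex.\<close>

lemma matching_count_absorb:
  "(a - 2 * d) * matching_count a d = a * matching_count (a - 1) d"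
proof -
  have "(a - 2 * d) * (a choose (2 * d)) = a * ((a - 1) choose (2 * d))"
    by (rule binomial_absorb_comp)
  then show ?thesis by (simp add: matching_count_def flip: mult.assoc)
qed

lemma two_times_choose_two: "2 * (n choose 2) = n * (n - 1)" for n :: nat
proof (induction n)
  case (Suc n)
  then show ?case by (cases n) (auto simp: numeral_2_eq_2 algebra_simps)
qed simp

text \<open>The analogue with two marked uncovered vertices, obtained by absorbing one after the
  other.\<close>

lemma matching_count_choose2:
  "((a - 2 * d) choose 2) * matching_count a d = (a choose 2) * matching_count (a - 2) d"
proof -
  have "2 * ((a - 2 * d) choose 2) * matching_count a d =
     (a - 2 * d) * matching_count a d * (a - 2 * d - 1)"
    unfolding two_times_choose_two by (simp only: mult_ac)
  also have "\<dots> = a * ((a - 1 - 2 * d) * matching_count (a - 1) d)"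
  proof -
    have "a - 2 * d - 1 = a - 1 - 2 * d" by simp
    then show ?thesis unfolding matching_count_absorb[of a d] by (simp only: mult_ac)
  qed
  also have "\<dots> = a * ((a - 1) * matching_count (a - 2) d)"
    unfolding matching_count_absorb by (simp add: numeral_2_eq_2)
  also have "\<dots> = 2 * (a choose 2) * matching_count (a - 2) d"
    unfolding two_times_choose_two by (simp only: mult_ac)
  finally show ?thesis by simp
qed

lemma matching_count_fact:
  assumes "2 * d \<le> a"
  shows "matching_count a d * (2 ^ d * fact d * fact (a - 2 * d)) = fact a"
proof -
  have "(\<Prod>j<d. 2 * j + 1) * (2 ^ d * fact d) = (fact (2 * d) :: nat)"
  proof (induction d)
    case (Suc d)
    have "(\<Prod>j<Suc d. 2 * j + 1) * (2 ^ Suc d * fact (Suc d)) =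
        (2 * d + 2) * (2 * d + 1) * ((\<Prod>j<d. 2 * j + 1) * (2 ^ d * fact d))"
      by (simp only: prod.lessThan_Suc fact_Suc power_Suc of_nat_id) (simp add: algebra_simps)
    then show ?case by (simp only: Suc.IH) (simp add: algebra_simps)
  qed simp
  then have "matching_count a d * (2 ^ d * fact d * fact (a - 2 * d))
     = (a choose (2 * d)) * fact (2 * d) * fact (a - 2 * d)"
    by (simp add: matching_count_def algebra_simps)
  also have "\<dots> = fact a" using binomial_fact_lemma[OF assms] by (simp only: mult_ac)
  finally show ?thesis .
qed

section \<open>Expansion of the involution numbers by double edges\<close>

text \<open>Adding a block of two points: none, exactly one, or both of them are swapped with old
  points. This mirrors the deletion of a vertex of bound 2.\<close>

lemma graph_count_0_rec:
  "graph_count 0 (n + 2) = 2 * graph_count 0 n + 2 * n * graph_count 0 (n - 1)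
     + n * (n - 1) * graph_count 0 (n - 2)"
  by (cases n) (auto simp: algebra_simps numeral_2_eq_2)

text \<open>There are \<open>a\<close> blocks and \<open>b\<close> single points, and
  \<open>d\<close> is the number of double edges. The induction removes one block; \<open>b\<close>
  varies because its neighbours become single points. The free bound \<open>N\<close> gives all sums
  in the step the same range, surplus terms being 0.\<close>

lemma graph_count_0_expansion:
  "a \<le> N \<Longrightarrow> graph_count 0 (2 * a + b) =
     (\<Sum>d\<le>N. 2 ^ (a - d) * matching_count a d * graph_count (a - 2 * d) b)"
proof (induction a arbitrary: b N rule: less_induct)
  case (less a)
  let ?f = "\<lambda>a d b. 2 ^ (a - d) * matching_count a d * graph_count (a - 2 * d) b"
  show ?case
  proof (cases a)
    case 0
    have "(\<Sum>d\<le>N. ?f 0 d b) = (\<Sum>d\<in>{0}. ?f 0 d b)"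
      by (rule sum.mono_neutral_right) (auto simp: matching_count_eq_0)
    then show ?thesis using 0 by simp
  next
    case (Suc m)
    have IH: "graph_count 0 (2 * a' + b') = (\<Sum>d\<le>N. ?f a' d b')" if "a' \<le> m" for a' b'
      using less.IH[of a' N b'] less.prems that Suc by simp
    \<comment> \<open>The six terms of the \<open>graph_count\<close> recurrence, each recast as a
      summand of a smaller expansion. The factors 2, 4 and 8 compensate for the exponents of 2
      falling with \<open>m\<close>, \<open>m - 1\<close> and \<open>m - 2\<close>.\<close>
    let ?R = "\<lambda>d. 2 * ?f m d b + 4 * m * ?f (m - 1) d (b + 1) + 2 * b * ?f m d (b - 1)
      + 8 * (m choose 2) * ?f (m - 2) d (b + 2) + 4 * m * b * ?f (m - 1) d b + 2 * (b choose 2) * ?f m d (b - 2)"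
    \<comment> \<open>The contribution of the matchings that avoid the last block.\<close>
    let ?g = "\<lambda>d. 2 ^ (Suc m - d) * matching_count m d * graph_count (Suc m - 2 * d) b"
    have g: "?g d = ?R d" for d
    proof (cases "2 * d \<le> m")
      case False
      then show ?thesis by (simp add: matching_count_eq_0)
    next
      case True
      let ?M = "matching_count m d" and ?c = "m - 2 * d"
      have p: "2 ^ (Suc m - d) = 2 * (2 :: nat) ^ (m - d)" using True by (simp add: Suc_diff_le)
      have "graph_count (Suc m - 2 * d) b = graph_count (Suc ?c) b"
        using True by (simp add: Suc_diff_le)
      then have "?g d = 2 * 2 ^ (m - d) * (?M * graph_count ?c b + (?c * ?M) * graph_count (?c - 1) (b + 1)
        + b * ?M * graph_count ?c (b - 1) + ((?c choose 2) * ?M) * graph_count (?c - 2) (b + 2)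
        + (?c * ?M) * b * graph_count (?c - 1) b + (b choose 2) * ?M * graph_count ?c (b - 2))"
        using p by (simp add: algebra_simps)
      also have "\<dots> = 2 * 2 ^ (m - d) * (?M * graph_count ?c b
        + (m * matching_count (m - 1) d) * graph_count (m - 1 - 2 * d) (b + 1)
        + b * ?M * graph_count ?c (b - 1)
        + ((m choose 2) * matching_count (m - 2) d) * graph_count (m - 2 - 2 * d) (b + 2)
        + (m * matching_count (m - 1) d) * b * graph_count (m - 1 - 2 * d) b
        + (b choose 2) * ?M * graph_count ?c (b - 2))"
        unfolding matching_count_absorb matching_count_choose2 by (simp add: diff_commute)
      also have "\<dots> = ?R d"
      proof -
        have p1: "2 * 2 ^ (m - d) * (m * matching_count (m - 1) d) = 4 * m * (2 ^ (m - 1 - d) * matching_count (m - 1) d)"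
        proof (cases "2 * d \<le> m - 1 \<and> 0 < m")
          case True
          then have "m - d = Suc (m - 1 - d)" by arith
          then show ?thesis by simp
        qed (auto simp: matching_count_eq_0)
        have p2: "2 * 2 ^ (m - d) * ((m choose 2) * matching_count (m - 2) d) =
          8 * (m choose 2) * (2 ^ (m - 2 - d) * matching_count (m - 2) d)"
        proof (cases "2 * d \<le> m - 2 \<and> 2 \<le> m")
          case True
          then have "m - d = Suc (Suc (m - 2 - d))" by arith
          then show ?thesis by simp
        qed (auto simp: matching_count_eq_0 not_le)
        have "2 * P * (M * G1 + mA * G2 + b * M * G3 + mC * G4 + mA * b * G5 + B * M * G6) =
          2 * (P * M * G1) + 2 * P * mA * G2 + 2 * b * (P * M * G3) + 2 * P * mC * G4
            + 2 * P * mA * b * G5 + 2 * B * (P * M * G6)" for P M mA mC B G1 G2 G3 G4 G5 G6 :: nat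
          by (simp only: distrib_left mult_ac)
        note * = this
        show ?thesis unfolding * p1 p2 by (simp only: mult_ac)
      qed
      finally show ?thesis .
    qed
    \<comment> \<open>The last block is outside the matching of double edges, or is matched with one
      of \<open>m\<close> others; the latter case lowers \<open>d\<close> by one.\<close>
    have "(\<Sum>d\<le>N. ?f a d b) = (\<Sum>d\<le>N. ?g d) + 2 * m * (\<Sum>d\<le>N. ?f (m - 1) d b)"
    proof -
      obtain N' where N: "N = Suc N'" using less.prems Suc by (cases N) auto
      \<comment> \<open>This restores the summand at \<open>N\<close> that the index shift
        loses.\<close>
      have z: "m = 0 \<or> matching_count (m - 1) N = 0"
        using less.prems Suc by (auto simp: matching_count_eq_0)
      have "(\<Sum>d\<le>N. ?f a d b) = ?f a 0 b + (\<Sum>d\<le>N'. ?f a (Suc d) b)"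
        unfolding N by (rule sum.atMost_Suc_shift)
      also have "(\<Sum>d\<le>N'. ?f a (Suc d) b) = (\<Sum>d\<le>N'. ?g (Suc d) + 2 * m * ?f (m - 1) d b)"
      proof (rule sum.cong[OF refl])
        fix d
        have "2 ^ (m - d) * (m * matching_count (m - 1) d) = 2 * m * (2 ^ (m - 1 - d) * matching_count (m - 1) d)"
        proof (cases "2 * d \<le> m - 1 \<and> 0 < m")
          case True
          then have "m - d = Suc (m - 1 - d)" by arith
          then show ?thesis by simp
        qed (auto simp: matching_count_eq_0)
        note * = this
        have "?f a (Suc d) b = ?g (Suc d)
          + 2 ^ (m - d) * (m * matching_count (m - 1) d) * graph_count (m - 1 - 2 * d) b"
          by (simp add: Suc matching_count_Suc_Suc algebra_simps)
        also have "\<dots> = ?g (Suc d) + 2 * m * ?f (m - 1) d b"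
          unfolding * by (simp only: mult_ac)
        finally show "?f a (Suc d) b = ?g (Suc d) + 2 * m * ?f (m - 1) d b" .
      qed
      also have "\<dots> = (\<Sum>d\<le>N'. ?g (Suc d)) + 2 * m * (\<Sum>d\<le>N'. ?f (m - 1) d b)"
        by (simp add: sum.distrib sum_distrib_left)
      also have "2 * m * (\<Sum>d\<le>N'. ?f (m - 1) d b) = 2 * m * (\<Sum>d\<le>N. ?f (m - 1) d b)"
        using z by (auto simp: N distrib_left)
      also have "?f a 0 b = ?g 0" using Suc by simp
      finally show ?thesis unfolding N sum.atMost_Suc_shift[of ?g] by simp
    qed
    also have "(\<Sum>d\<le>N. ?g d) = (\<Sum>d\<le>N. ?R d)" using g by simp
    also have "\<dots> = 2 * (\<Sum>d\<le>N. ?f m d b) + 4 * m * (\<Sum>d\<le>N. ?f (m - 1) d (b + 1))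
      + 2 * b * (\<Sum>d\<le>N. ?f m d (b - 1)) + 8 * (m choose 2) * (\<Sum>d\<le>N. ?f (m - 2) d (b + 2))
      + 4 * m * b * (\<Sum>d\<le>N. ?f (m - 1) d b) + 2 * (b choose 2) * (\<Sum>d\<le>N. ?f m d (b - 2))"
      by (simp only: sum.distrib sum_distrib_left)
    also have "\<dots> + 2 * m * (\<Sum>d\<le>N. ?f (m - 1) d b) =
      2 * graph_count 0 (2 * m + b) + 4 * m * graph_count 0 (2 * (m - 1) + (b + 1))
      + 2 * b * graph_count 0 (2 * m + (b - 1)) + 8 * (m choose 2) * graph_count 0 (2 * (m - 2) + (b + 2))
      + 4 * m * b * graph_count 0 (2 * (m - 1) + b) + 2 * (b choose 2) * graph_count 0 (2 * m + (b - 2))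
      + 2 * m * graph_count 0 (2 * (m - 1) + b)"
      by (simp only: IH diff_le_self order_refl)
    also have "\<dots> = 2 * graph_count 0 (2 * m + b) + 2 * (2 * m + b) * graph_count 0 (2 * m + b - 1)
      + (2 * m + b) * (2 * m + b - 1) * graph_count 0 (2 * m + b - 2)"
    proof -
      let ?T = "graph_count 0"
      \<comment> \<open>In facts 1 to 5 the truncated indices agree whenever the coefficient is
        nonzero.\<close>
      have 1: "m * ?T (2 * (m - 1) + (b + 1)) = m * ?T (2 * m + b - 1)" by (cases m) auto
      have 2: "b * ?T (2 * m + (b - 1)) = b * ?T (2 * m + b - 1)" by (cases b) auto
      have 3: "(m choose 2) * ?T (2 * (m - 2) + (b + 2)) = (m choose 2) * ?T (2 * m + b - 2)"
      proof (cases "2 \<le> m")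
        case True
        then have "2 * (m - 2) + (b + 2) = 2 * m + b - 2" by arith
        then show ?thesis by (simp only:)
      qed (simp add: binomial_eq_0)
      have 4: "m * ?T (2 * (m - 1) + b) = m * ?T (2 * m + b - 2)" by (cases m) simp_all
      have 5: "(b choose 2) * ?T (2 * m + (b - 2)) = (b choose 2) * ?T (2 * m + b - 2)"
      proof (cases "2 \<le> b")
        case True
        then have "2 * m + (b - 2) = 2 * m + b - 2" by arith
        then show ?thesis by (simp only:)
      qed (simp add: binomial_eq_0)
      \<comment> \<open>Ordered pairs of distinct points: in two different blocks, both single, one
        of each kind, or in the same block. The last kind is the double-edge term.\<close>
      have "(2 * m + b) * (2 * m + b - 1) = 4 * (m * (m - 1)) + b * (b - 1) + 4 * m * b + 2 * m"
        by (cases m; cases b) (auto simp: algebra_simps)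
      then have 6: "(2 * m + b) * (2 * m + b - 1) = 8 * (m choose 2) + 2 * (b choose 2) + 4 * m * b + 2 * m"
        using two_times_choose_two[of m] two_times_choose_two[of b] by linarith
      have "2 * T + 4 * m * X1 + 2 * b * X2 + 8 * C * X3 + 4 * m * b * X4 + 2 * B * X5 + 2 * m * X4 =
          2 * T + 2 * (2 * m + b) * Y1 + (8 * C + 2 * B + 4 * m * b + 2 * m) * Y2"
        if "m * X1 = m * Y1" "b * X2 = b * Y1" "C * X3 = C * Y2" "m * X4 = m * Y2" "B * X5 = B * Y2"
        for T X1 X2 X3 X4 X5 Y1 Y2 B C :: nat
      proof -
        have "2 * T + 4 * m * X1 + 2 * b * X2 + 8 * C * X3 + 4 * m * b * X4 + 2 * B * X5 + 2 * m * X4 =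
          2 * T + 4 * (m * X1) + 2 * (b * X2) + 8 * (C * X3) + 4 * b * (m * X4) + 2 * (B * X5) + 2 * (m * X4)"
          by (simp only: mult_ac)
        then show ?thesis unfolding that by (simp add: algebra_simps)
      qed
      from this[OF 1 2 3 4 5] show ?thesis unfolding 6 .
    qed
    also have "\<dots> = graph_count 0 (2 * a + b)"
      using graph_count_0_rec[of "2 * m + b"] Suc by simp
    finally show ?thesis ..
  qed
qed

section \<open>Products of odd numbers and the sum for n = 4k + r\<close>

text \<open>The factorial splits into its odd factors and its \<open>k\<close> even factors.\<close>

lemma fact_eq_step_prod:
  assumes "s < 2"
  shows "fact (2 * k + s) = step_prod 1 2 (k + s) * (2 ^ k * (fact k :: 'a :: field_char_0))"
proof -
  have even: "fact (2 * k) = step_prod 1 2 k * (2 ^ k * (fact k :: 'a))" for k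
    by (induction k) (simp_all add: step_prod_def algebra_simps)
  have "s = 0 \<or> s = 1" using assms by auto
  then show ?thesis using even[of k] by (auto simp: step_prod_def algebra_simps)
qed

lemma step_prod_1_2_nonzero: "step_prod 1 2 m \<noteq> (0 :: rat)"
proof -
  have "1 + rat_of_nat j * 2 \<noteq> 0" for j
    using of_nat_0_le_iff[of j, where 'a = rat] by linarith
  then show ?thesis by (simp add: step_prod_def)
qed

text \<open>In the factorial formula the powers of 2 cancel, the even factors leave the binomial
  coefficient, and the odd factors leave the quotient.\<close>

lemma matching_count_step_prod:
  assumes "i \<le> k" "s < 2"
  shows "rat_of_nat (matching_count (2 * k + s) (k - i)) =
    of_nat (k choose i) * (step_prod 1 2 (k + s) / step_prod 1 2 (i + s))"
proof -
  have "2 * k + s - 2 * (k - i) = 2 * i + s" using assms by simp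
  then have "matching_count (2 * k + s) (k - i) * (2 ^ (k - i) * fact (k - i) * fact (2 * i + s)) = fact (2 * k + s)"
    using matching_count_fact[of "k - i" "2 * k + s"] by simp
  from arg_cong[OF this, of rat_of_nat]
  have "rat_of_nat (matching_count (2 * k + s) (k - i)) * (2 ^ (k - i) * fact (k - i) * fact (2 * i + s)) = fact (2 * k + s)"
    by (simp only: of_nat_mult of_nat_power of_nat_fact of_nat_numeral)
  then have "rat_of_nat (matching_count (2 * k + s) (k - i)) * (2 ^ (k - i) * fact (k - i) * (step_prod 1 2 (i + s) * (2 ^ i * fact i)))
     = step_prod 1 2 (k + s) * (2 ^ k * fact k)"
    using assms by (simp only: fact_eq_step_prod)
  also have "(2::rat) ^ k = 2 ^ (k - i) * 2 ^ i" using assms by (simp flip: power_add)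
  also have "(fact k :: rat) = of_nat (fact i * fact (k - i) * (k choose i))"
    using binomial_fact_lemma[OF assms(1)] by simp
  finally have "(2 ^ (k - i) * 2 ^ i * fact i * fact (k - i)) *
      (rat_of_nat (matching_count (2 * k + s) (k - i)) * step_prod 1 2 (i + s)) =
    (2 ^ (k - i) * 2 ^ i * fact i * fact (k - i)) * (of_nat (k choose i) * step_prod 1 2 (k + s))"
    by (simp only: of_nat_mult of_nat_fact mult_ac)
  then have "rat_of_nat (matching_count (2 * k + s) (k - i)) * step_prod 1 2 (i + s) =
      of_nat (k choose i) * step_prod 1 2 (k + s)"
    by (rule mult_left_cancel[THEN iffD1, rotated]) simp
  then show ?thesis using step_prod_1_2_nonzero[of "i + s"] by (simp add: eq_divide_eq)
qed

text \<open>Set \<open>d = k - i\<close> in the expansion with \<open>2 * k + r div 2\<close>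
  blocks: the power of 2 becomes \<open>k + r div 2 + i\<close>, so a common factor comes
  out.\<close>

lemma num_involutions_expansion:
  assumes "n = 4 * k + r" "r < 4"
  shows "num_involutions n = 2 ^ (k + r div 2) *
    (\<Sum>i\<le>k. 2 ^ i * matching_count (2 * k + r div 2) (k - i) * num_simple (4 * i + r))"
proof -
  let ?u = "2 * k + r div 2"
  let ?h = "\<lambda>d. 2 ^ (?u - d) * matching_count ?u d * graph_count (?u - 2 * d) (r mod 2)"
  have "n = 2 * ?u + r mod 2" using assms by simp
  then have "num_involutions n = (\<Sum>d\<le>?u. ?h d)"
    using graph_count_0_expansion[of ?u ?u "r mod 2"] by (simp only: num_involutions_eq)
  \<comment> \<open>As \<open>r div 2 < 2\<close>, more than \<open>k\<close> edges would need more
    blocks than exist.\<close>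
  also have "\<dots> = (\<Sum>d\<le>k. ?h d)"
    using assms by (intro sum.mono_neutral_right) (auto simp: matching_count_eq_0)
  also have "\<dots> = (\<Sum>i\<le>k. ?h (k - i))"
    using sum.nat_diff_reindex[of ?h "Suc k"] by (simp add: lessThan_Suc_atMost)
  also have "\<dots> = (\<Sum>i\<le>k. 2 ^ (k + r div 2) *
      (2 ^ i * matching_count ?u (k - i) * num_simple (4 * i + r)))"
  proof (rule sum.cong[OF refl])
    fix i assume "i \<in> {..k}"
    then have "?u - (k - i) = k + r div 2 + i" "?u - 2 * (k - i) = 2 * i + r div 2" by auto
    moreover have "num_simple (4 * i + r) = graph_count (2 * i + r div 2) (r mod 2)"
    proof -
      have "(4 * i + r) div 2 = 2 * i + r div 2" "(4 * i + r) mod 2 = r mod 2" by presburger+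
      then show ?thesis by (simp only: num_simple_eq)
    qed
    ultimately show "?h (k - i) = 2 ^ (k + r div 2) *
      (2 ^ i * matching_count ?u (k - i) * num_simple (4 * i + r))"
      by (simp add: power_add)
  qed
  finally show ?thesis by (simp add: sum_distrib_left)
qed

section \<open>Parity of the summands and the final formula\<close>

text \<open>The binomial coefficient is 1 or \<open>2 * k + 1\<close>, and the other factor is a
  product of odd numbers.\<close>

lemma odd_matching_count:
  assumes "s < 2"
  shows "odd (matching_count (2 * k + s) k)"
proof -
  have "odd (\<Prod>j<k. 2 * j + 1)" by (induction k) auto
  then show ?thesis using assms by (auto simp: matching_count_def less_2_cases_iff)
qed

text \<open>The even value g_3 = 2 is the source of the correction for \<open>r = 3\<close>.\<close>

lemma num_simple_base: "num_simple r = (if r = 3 then 2 else 1)" if "r < 4"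
proof -
  have "r = 0 \<or> r = 1 \<or> r = 2 \<or> r = 3" using that by auto
  then show ?thesis by (auto simp: num_simple_eq)
qed

text \<open>That g_7 is even supplies the second factor 2 in the summand \<open>i = 1\<close> for
  \<open>r = 3\<close>.\<close>

lemma num_simple_7: "num_simple 7 = 26"
  by (simp add: num_simple_eq) (simp add: eval_nat_numeral)

theorem theorem3p3:
  fixes n k r :: nat
  assumes "n = 4 * k + r" and "r < 4"
  shows "ord2 (num_involutions n) = k + r div 2 + of_bool (r = 3) \<and>
    int (ord2 (num_involutions n)) =
      int (n div 2) - 2 * int (n div 4) + int ((n + 1) div 4) \<and>
    odd_factor n =
      (\<Sum>i=0..k. 2 powi (int i - of_bool (r = 3)) * of_nat (k choose i) *
         (step_prod 1 2 (k + r div 2) / step_prod 1 2 (i + r div 2)) *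
         of_nat (num_simple (4 * i + r)))"
proof -
  let ?s = "r div 2" and ?\<delta> = "of_bool (r = 3) :: nat"
  let ?Q = "\<lambda>i. matching_count (2 * k + ?s) (k - i)"
  let ?t = "\<lambda>i. 2 ^ i * ?Q i * num_simple (4 * i + r)"
  have s: "?s < 2" using assms by auto
  have t: "num_involutions n = 2 ^ (k + ?s) * (\<Sum>i\<le>k. ?t i)"
    using num_involutions_expansion[OF assms] .
  have split: "(\<Sum>i\<le>k. ?t i) = ?t 0 + (\<Sum>i\<in>{1..k}. ?t i)"
    by (simp add: sum.atLeast1_atMost_eq sum.atMost_shift lessThan_Suc_atMost)
  obtain c where c: "(\<Sum>i\<le>k. ?t i) = 2 ^ ?\<delta> * c" "odd c"
  proof (cases "r = 3")
    case False
    have "even (\<Sum>i\<in>{1..k}. ?t i)" by (rule dvd_sum) auto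
    moreover have "odd (?t 0)"
      using False num_simple_base[OF assms(2)] odd_matching_count[OF s] by simp
    ultimately have "odd (\<Sum>i\<le>k. ?t i)" unfolding split by simp
    then show ?thesis using that False by simp
  next
    case True
    \<comment> \<open>The summand at 0 is twice an odd number here, so the others must vanish modulo
      4. From \<open>i = 2\<close> on the power of 2 suffices; at \<open>i = 1\<close> one has 2 *
      26 = 4 * 13.\<close>
    have "4 dvd (\<Sum>i\<in>{1..k}. ?t i)"
    proof (rule dvd_sum)
      fix i assume "i \<in> {1..k}"
      then consider "i = 1" | j where "i = j + 2"
        by (metis One_nat_def add_2_eq_Suc' atLeastAtMost_iff le_zero_eq not0_implies_Suc nat.simps(3))
      then show "4 dvd ?t i"
      proof cases
        case 1
        then have "?t i = 4 * (13 * ?Q 1)" using True num_simple_7 by simp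
        then show ?thesis by (metis dvd_triv_left)
      next
        case 2
        then have "?t i = 4 * (2 ^ j * ?Q i * num_simple (4 * i + r))" by simp
        then show ?thesis by (metis dvd_triv_left)
      qed
    qed
    then obtain e where e: "(\<Sum>i\<in>{1..k}. ?t i) = 4 * e" by blast
    have "?t 0 = 2 * ?Q 0" using True num_simple_base[OF assms(2)] by simp
    then have "(\<Sum>i\<le>k. ?t i) = 2 * (?Q 0 + 2 * e)" unfolding split e by simp
    then have "(\<Sum>i\<le>k. ?t i) = 2 ^ ?\<delta> * (?Q 0 + 2 * e)" using True by simp
    moreover have "odd (?Q 0 + 2 * e)" using odd_matching_count[OF s] by simp
    ultimately show ?thesis by (rule that)
  qed
  then have tc: "num_involutions n = 2 ^ (k + ?s + ?\<delta>) * c" using t by (simp add: power_add)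
  have ord: "ord2 (num_involutions n) = k + ?s + ?\<delta>"
    unfolding ord2_def tc using c(2) by (intro multiplicity_eqI) auto
  have "r = 0 \<or> r = 1 \<or> r = 2 \<or> r = 3" using assms(2) by auto
  then have "int (k + ?s + ?\<delta>) = int (n div 2) - 2 * int (n div 4) + int ((n + 1) div 4)"
    using assms(1) by auto
  moreover have "odd_factor n = (\<Sum>i=0..k. 2 powi (int i - of_bool (r = 3)) * of_nat (k choose i) *
         (step_prod 1 2 (k + ?s) / step_prod 1 2 (i + ?s)) * of_nat (num_simple (4 * i + r)))"
  proof -
    have "odd_factor n = of_nat (\<Sum>i\<le>k. ?t i) / 2 ^ ?\<delta>"
    proof -
      have "odd_factor n = of_nat (2 ^ (k + ?s) * (\<Sum>i\<le>k. ?t i)) / 2 ^ (k + ?s + ?\<delta>)"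
        by (simp only: odd_factor_def ord) (simp only: t)
      also have "\<dots> = (2 ^ (k + ?s) * of_nat (\<Sum>i\<le>k. ?t i)) / (2 ^ (k + ?s) * 2 ^ ?\<delta>)"
        by (simp only: of_nat_mult of_nat_power of_nat_numeral power_add)
      also have "\<dots> = of_nat (\<Sum>i\<le>k. ?t i) / 2 ^ ?\<delta>" by simp
      finally show ?thesis .
    qed
    also have "\<dots> = (\<Sum>i\<le>k. of_nat (?t i) / 2 ^ ?\<delta>)" by (simp add: sum_divide_distrib)
    also have "\<dots> = (\<Sum>i\<le>k. 2 powi (int i - of_bool (r = 3)) * of_nat (k choose i) *
         (step_prod 1 2 (k + ?s) / step_prod 1 2 (i + ?s)) * of_nat (num_simple (4 * i + r)))"
    proof (rule sum.cong[OF refl])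
      fix i assume "i \<in> {..k}"
      then have Q: "rat_of_nat (?Q i) =
          of_nat (k choose i) * (step_prod 1 2 (k + ?s) / step_prod 1 2 (i + ?s))"
        using matching_count_step_prod[of i k ?s] s by simp
      \<comment> \<open>The integer exponent is -1 for \<open>i = 0\<close> and
        \<open>r = 3\<close>.\<close>
      have p: "(2 :: rat) powi (int i - of_bool (r = 3)) = 2 ^ i / 2 ^ ?\<delta>"
        by (simp add: power_int_diff)
      have t: "rat_of_nat (?t i) = 2 ^ i * of_nat (?Q i) * of_nat (num_simple (4 * i + r))"
        by simp
      show "rat_of_nat (?t i) / 2 ^ ?\<delta> = 2 powi (int i - of_bool (r = 3)) * of_nat (k choose i) *
         (step_prod 1 2 (k + ?s) / step_prod 1 2 (i + ?s)) * of_nat (num_simple (4 * i + r))"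
        unfolding t Q p
        by (simp only: mult_ac times_divide_eq_left times_divide_eq_right divide_divide_eq_left)
    qed
    finally show ?thesis by (simp add: atMost_atLeast0)
  qed
  ultimately show ?thesis using ord by simp
qed

end
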